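(* Let $d\ge 2$ and write $[d]:=\{1,\dots,d\}$. Then, for every $d$-dimensional real-valued centered Gaussian vector $(G_1,\dots,G_d)$ whose entries have unit variance, $$\sum_{\{i_1,\dots,i_k\}\subseteq[d]}E\big[G_{i_1}^4\cdots G_{i_k}^4\big]\ \ge\ \sum_{\{i_1,\dots,i_k\}\subseteq[d]}E\big[G_{i_1}^4\big]\cdots E\big[G_{i_k}^4\big],$$ where both sums run over all subsets $\{i_1,\dots,i_k\}$ (with distinct elements, of any size $k$) of $[d]$.
   Context: $E$ denotes mathematical expectation. An empty product, if the empty subset is included, equals $1$ (it contributes the same amount to both sides). *)

theory Defs
  imports "HOL-Probability.Probability"
begin

(* The normal law with mean m and standard deviation s; for s = 0 it is the Dirac
   measure at m, which the library's normal_density (s > 0) does not cover. *)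
definition normal_law :: "real \<Rightarrow> real \<Rightarrow> real measure" where
  "normal_law m s =
     (if s = 0 then return borel m
      else density lborel (\<lambda>x. ennreal (normal_density m s x)))"

(* Every linear combination of the entries is (possibly degenerate) normal.
   Degenerate laws are admitted, so the covariance matrix may be singular. *)
definition gaussian_vector :: "'a measure \<Rightarrow> nat \<Rightarrow> (nat \<Rightarrow> 'a \<Rightarrow> real) \<Rightarrow> bool" where
  "gaussian_vector M d G \<longleftrightarrow>
     (\<forall>i\<in>{1..d}. G i \<in> borel_measurable M) \<and>
     (\<forall>c :: nat \<Rightarrow> real. \<exists>m s. 0 \<le> s \<and>
        distr M borel (\<lambda>\<omega>. \<Sum>i\<in>{1..d}. c i * G i \<omega>) = normal_law m s)"

end

theory Submission
  imports Defs
begin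

text \<open>
  Summing over subsets \<open>S\<close> amounts to expanding a product: the claim is
  \<open>E[\<Prod>\<^sub>j (1 + G\<^sub>j^4)] \<ge> 4^d\<close>, because \<open>E[G\<^sub>j^4] = 3\<close>. The idea is the decomposition into squares
  of Hermite polynomials \<open>1 + x^4 = 2 x\<^sup>2 + (x\<^sup>2 - 1)\<^sup>2\<close>. It writes the expectation as the sum over
  all \<open>T\<close> of \<open>2^|T| E[Q\<^sub>T\<^sup>2]\<close>, where \<open>Q\<^sub>T\<close> is the product of the \<open>G\<^sub>j\<close> with \<open>j \<in> T\<close> and the
  \<open>G\<^sub>j\<^sup>2 - 1\<close> with \<open>j \<notin> T\<close>. It suffices that \<open>E[Q\<^sub>T\<^sup>2] \<ge> 2^(d-|T|)\<close>, since the sum of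
  \<open>2^|T| 2^(d-|T|)\<close> over all \<open>T\<close> is \<open>4^d\<close>.

  This is an instance of \<open>expectation_square_prod_ge\<close>: if each \<open>p\<^sub>j\<close> is monic of degree \<open>n\<^sub>j\<close>, then
  \<open>E[\<Prod>\<^sub>j p\<^sub>j(G\<^sub>j)\<^sup>2] \<ge> \<Prod>\<^sub>j n\<^sub>j!\<close>, however the unit-variance Gaussians \<open>G\<^sub>j\<close> are correlated.
  Its proof works in the space of polynomials in \<open>G\<close> with the inner product \<open>E[f(G) g(G)]\<close>. Let
  \<open>D\<^sub>i\<close> be the derivative in the direction of the \<open>i\<close>-th row of the covariance matrix. By Stein's
  formula its adjoint is the creation operator \<open>A\<^sub>i f = x\<^sub>i f - D\<^sub>i f\<close>. Applying \<open>n\<close> creation operators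
  to \<open>1\<close> gives a Wick product \<open>W\<close>, which has the same leading monomial as the corresponding product of
  coordinates and is orthogonal to all polynomials of degree less than \<open>n\<close>. Hence any \<open>Q\<close> with this
  leading monomial satisfies \<open>E[Q\<^sup>2] \<ge> E[W\<^sup>2]\<close> (\<open>wick_monomial_minimizes\<close>). The commutation rule
  \<open>D\<^sub>i A\<^sub>i = A\<^sub>i D\<^sub>i + 1\<close>, valid as \<open>G\<^sub>i\<close> has unit variance, implies
  \<open>\<parallel>A\<^sub>i^n f\<parallel>\<^sup>2 \<ge> n! \<parallel>f\<parallel>\<^sup>2\<close> for every polynomial \<open>f\<close> (\<open>wick_power_norm\<close>), and so
  \<open>E[W\<^sup>2] \<ge> \<Prod>\<^sub>j n\<^sub>j!\<close>.

  Stein's formula \<open>E[G\<^sub>i f(G)] = E[(D\<^sub>i f)(G)]\<close> has to be derived from the laws of the linear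
  combinations alone. For a power of a linear form it is the derivative, in direction \<open>x\<^sub>i\<close>, of the
  one-dimensional recursion \<open>E[Y^(n+2)] = (n+1) E[Y\<^sup>2] E[Y^n]\<close>; polarization
  (\<open>functional_vanishing_on_powers\<close>) extends it to all polynomials. This involves
  moments only and no joint density, so the covariance matrix may be singular.
\<close>

section \<open>Polynomial functions of bounded degree\<close>

definition monomial :: "'i list \<Rightarrow> ('i \<Rightarrow> real) \<Rightarrow> real" where
  "monomial l x = (\<Prod>k\<leftarrow>l. x k)"

lemma monomial_Nil [simp]: "monomial [] x = 1"
  and monomial_Cons [simp]: "monomial (k # l) x = x k * monomial l x"
  and monomial_append [simp]: "monomial (l @ l') x = monomial l x * monomial l' x"
  by (simp_all add: monomial_def)

text \<open>
  Polynomial functions in the coordinates from \<open>I\<close> of degree strictly less than \<open>n\<close>. With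
  the strict bound a derivative maps level \<open>Suc n\<close> to level \<open>n\<close>, level \<open>0\<close> consists of the zero
  function only, and "\<open>f\<close> has leading monomial \<open>l\<close>" reads \<open>poly_lt I (length l) (f - monomial l)\<close>,
  with no exception for the empty product.
\<close>

inductive poly_lt :: "'i set \<Rightarrow> nat \<Rightarrow> (('i \<Rightarrow> real) \<Rightarrow> real) \<Rightarrow> bool" for I n where
  zero: "poly_lt I n (\<lambda>x. 0)"
| step: "poly_lt I n f \<Longrightarrow> set l \<subseteq> I \<Longrightarrow> length l < n \<Longrightarrow> poly_lt I n (\<lambda>x. c * monomial l x + f x)"

lemma poly_lt_monomial:
  assumes "set l \<subseteq> I" "length l < n"
  shows "poly_lt I n (monomial l)"
  using poly_lt.step[OF poly_lt.zero assms, of 1] by simp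

lemma poly_lt_lin:
  assumes "poly_lt I n f" "poly_lt I n g"
  shows "poly_lt I n (\<lambda>x. c * f x + g x)"
  using assms(1)
proof induction
  case zero
  show ?case using assms(2) by simp
next
  case (step f l a)
  show ?case
    using poly_lt.step[OF step.IH step.hyps(2,3), of "c * a"] by (simp add: algebra_simps)
qed

lemma poly_lt_add: "poly_lt I n f \<Longrightarrow> poly_lt I n g \<Longrightarrow> poly_lt I n (\<lambda>x. f x + g x)"
  using poly_lt_lin[of I n f g 1] by simp

lemma poly_lt_scale: "poly_lt I n f \<Longrightarrow> poly_lt I n (\<lambda>x. c * f x)"
  using poly_lt_lin[of I n f "\<lambda>x. 0" c] by (simp add: poly_lt.zero)

lemma poly_lt_diff: "poly_lt I n f \<Longrightarrow> poly_lt I n g \<Longrightarrow> poly_lt I n (\<lambda>x. f x - g x)"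
  using poly_lt_lin[of I n g f "-1"] by simp

lemma poly_lt_weaken:
  assumes "poly_lt I m f" "m \<le> n"
  shows "poly_lt I n f"
  using assms(1) by induction (use assms(2) in \<open>auto intro: poly_lt.intros\<close>)

lemma poly_lt_const: "0 < n \<Longrightarrow> poly_lt I n (\<lambda>x. c)"
  using poly_lt.step[OF poly_lt.zero, of "[]" I n c] by simp

lemma poly_lt_monomial_mult:
  assumes "poly_lt I n f" "set l \<subseteq> I"
  shows "poly_lt I (length l + n) (\<lambda>x. monomial l x * f x)"
  using assms(1)
proof induction
  case zero
  show ?case by (simp add: poly_lt.zero)
next
  case (step f l' c)
  have "poly_lt I (length l + n) (\<lambda>x. c * monomial (l @ l') x + monomial l x * f x)"
    by (rule poly_lt.step[OF step.IH]) (use assms(2) step.hyps in auto)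
  then show ?case by (simp add: algebra_simps)
qed

lemma poly_lt_coord_mult:
  assumes "poly_lt I n f" "i \<in> I"
  shows "poly_lt I (Suc n) (\<lambda>x. x i * f x)"
  using poly_lt_monomial_mult[OF assms(1), of "[i]"] assms(2) by simp

lemma poly_lt_mult:
  assumes "poly_lt I n f" "poly_lt I m g"
  shows "poly_lt I (n + m) (\<lambda>x. f x * g x)"
  using assms(1)
proof induction
  case zero
  show ?case by (simp add: poly_lt.zero)
next
  case (step f l c)
  have "poly_lt I (n + m) (\<lambda>x. monomial l x * g x)"
    by (rule poly_lt_weaken[OF poly_lt_monomial_mult[OF assms(2) step.hyps(2)]]) (use step.hyps in auto)
  from poly_lt_lin[OF this step.IH, of c] show ?case
    by (simp add: algebra_simps)
qed

definition is_poly :: "'i set \<Rightarrow> (('i \<Rightarrow> real) \<Rightarrow> real) \<Rightarrow> bool" where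
  "is_poly I f \<longleftrightarrow> (\<exists>n. poly_lt I n f)"

lemma is_polyI: "poly_lt I n f \<Longrightarrow> is_poly I f"
  by (auto simp: is_poly_def)

lemma is_poly_lin:
  assumes "is_poly I f" "is_poly I g"
  shows "is_poly I (\<lambda>x. c * f x + g x)"
proof -
  obtain n m where "poly_lt I n f" "poly_lt I m g"
    using assms by (auto simp: is_poly_def)
  then have "poly_lt I (max n m) f" "poly_lt I (max n m) g"
    by (auto intro: poly_lt_weaken)
  then show ?thesis by (blast intro: is_polyI poly_lt_lin)
qed

lemma is_poly_mult [intro]: "is_poly I f \<Longrightarrow> is_poly I g \<Longrightarrow> is_poly I (\<lambda>x. f x * g x)"
  unfolding is_poly_def using poly_lt_mult by blast

lemma is_poly_const [intro]: "is_poly I (\<lambda>x. c)"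
  by (rule is_polyI[OF poly_lt_const[of 1]]) simp

lemma is_poly_coord [intro]: "i \<in> I \<Longrightarrow> is_poly I (\<lambda>x. x i)"
proof -
  assume "i \<in> I"
  moreover have "monomial [i] = (\<lambda>x. x i)" by (simp add: fun_eq_iff)
  ultimately show "is_poly I (\<lambda>x. x i)"
    using poly_lt_monomial[of "[i]" I 2] by (auto intro: is_polyI)
qed

lemma is_poly_monomial [intro]: "set l \<subseteq> I \<Longrightarrow> is_poly I (monomial l)"
  using poly_lt_monomial[of l I "Suc (length l)"] by (auto simp: is_poly_def)

lemma is_poly_add [intro]: "is_poly I f \<Longrightarrow> is_poly I g \<Longrightarrow> is_poly I (\<lambda>x. f x + g x)"
  using is_poly_lin[of I f g 1] by simp

lemma is_poly_diff [intro]: "is_poly I f \<Longrightarrow> is_poly I g \<Longrightarrow> is_poly I (\<lambda>x. f x - g x)"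
  using is_poly_lin[of I g f "-1"] by simp

lemma is_poly_power [intro]: "is_poly I f \<Longrightarrow> is_poly I (\<lambda>x. f x ^ n)"
  by (induction n) auto

lemma is_poly_sum [intro]:
  "(\<And>j. j \<in> J \<Longrightarrow> is_poly I (f j)) \<Longrightarrow> is_poly I (\<lambda>x. \<Sum>j\<in>J. f j x)"
  by (induction J rule: infinite_finite_induct) auto

lemma is_poly_prod [intro]:
  "(\<And>j. j \<in> J \<Longrightarrow> is_poly I (f j)) \<Longrightarrow> is_poly I (\<lambda>x. \<Prod>j\<in>J. f j x)"
  by (induction J rule: infinite_finite_induct) auto

lemma is_poly_induct [consumes 1, case_names zero step]:
  assumes "is_poly I f"
    and "P (\<lambda>x. 0)"
    and "\<And>c l f. set l \<subseteq> I \<Longrightarrow> is_poly I f \<Longrightarrow> P f \<Longrightarrow> P (\<lambda>x. c * monomial l x + f x)"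
  shows "P f"
proof -
  obtain n where "poly_lt I n f" using assms(1) by (auto simp: is_poly_def)
  then show ?thesis
    by induction (auto intro: assms(2,3) is_polyI)
qed

section \<open>Polarization\<close>

lemma linear_functional_sum:
  fixes B :: "(('i \<Rightarrow> real) \<Rightarrow> real) \<Rightarrow> real"
  assumes lin: "\<And>c f g. is_poly I f \<Longrightarrow> is_poly I g \<Longrightarrow> B (\<lambda>x. c * f x + g x) = c * B f + B g"
    and zero: "B (\<lambda>x. 0) = 0"
    and "finite J" and "\<And>j. j \<in> J \<Longrightarrow> is_poly I (f j)"
  shows "B (\<lambda>x. \<Sum>j\<in>J. c j * f j x) = (\<Sum>j\<in>J. c j * B (f j))"
  using assms(3,4)
proof (induction J)
  case empty
  then show ?case by (simp add: zero)
next
  case (insert j J)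
  have "is_poly I (\<lambda>x. \<Sum>j\<in>J. c j * f j x)"
    using insert.prems by (intro is_poly_sum is_poly_mult is_poly_const) auto
  with insert show ?case by (simp add: lin)
qed

text \<open>
  Powers of linear forms span all polynomials. Suppose that \<open>B\<close> kills \<open>m Y^n\<close> for a fixed
  monomial \<open>m\<close> and all linear forms \<open>Y\<close>. Then it kills \<open>m (Y + t x\<^sub>k)^(n+1)\<close> for every real \<open>t\<close>;
  this is a polynomial in \<open>t\<close>, so its linear coefficient \<open>(n+1) B (m x\<^sub>k Y^n)\<close> vanishes too, and
  \<open>m\<close> has grown by one factor.
\<close>

lemma functional_vanishing_on_powers:
  fixes B :: "(('i \<Rightarrow> real) \<Rightarrow> real) \<Rightarrow> real"
  assumes "finite I"
    and lin: "\<And>c f g. is_poly I f \<Longrightarrow> is_poly I g \<Longrightarrow> B (\<lambda>x. c * f x + g x) = c * B f + B g"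
    and zero: "B (\<lambda>x. 0) = 0"
    and powers: "\<And>a n. B (\<lambda>x. (\<Sum>i\<in>I. a i * x i) ^ n) = 0"
    and "is_poly I f"
  shows "B f = 0"
proof -
  have *: "B (\<lambda>x. monomial l x * (\<Sum>i\<in>I. a i * x i) ^ n) = 0" if "set l \<subseteq> I" for l a n
    using that
  proof (induction l arbitrary: a n)
    case Nil
    then show ?case by (simp add: powers)
  next
    case (Cons k l)
    let ?Y = "\<lambda>x. \<Sum>i\<in>I. a i * x i"
    let ?f = "\<lambda>j x. monomial l x * (x k ^ j * ?Y x ^ (Suc n - j))"
    have k: "k \<in> I" and l: "set l \<subseteq> I" using Cons.prems by auto
    have poly: "is_poly I (?f j)" for j
      using k l by (intro is_poly_mult is_poly_power is_poly_monomial is_poly_coord is_poly_sum) auto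
    have "(\<Sum>j\<le>Suc n. (of_nat (Suc n choose j) * B (?f j)) * t ^ j) = 0" for t
    proof -
      define b where "b = (\<lambda>i. a i + (if i = k then t else 0))"
      have b: "(\<Sum>i\<in>I. b i * x i) = t * x k + ?Y x" for x
        using k \<open>finite I\<close> by (simp add: b_def algebra_simps sum.distrib if_distrib[of "\<lambda>t. _ * t"] cong: if_cong)
      have "0 = B (\<lambda>x. monomial l x * (\<Sum>i\<in>I. b i * x i) ^ Suc n)"
        using Cons.IH[OF l, of b "Suc n"] by simp
      also have "\<dots> = B (\<lambda>x. \<Sum>j\<le>Suc n. (of_nat (Suc n choose j) * t ^ j) * ?f j x)"
        unfolding b binomial_ring sum_distrib_left by (simp only: power_mult_distrib mult_ac)
      also have "\<dots> = (\<Sum>j\<le>Suc n. (of_nat (Suc n choose j) * t ^ j) * B (?f j))"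
        using poly by (intro linear_functional_sum[OF lin zero]) auto
      finally show ?thesis by (simp only: mult_ac)
    qed
    then have "of_nat (Suc n choose 1) * B (?f 1) = 0"
      using polyfun_eq_0[of "\<lambda>j. of_nat (Suc n choose j) * B (?f j)" "Suc n"] by auto
    then show ?case by (simp add: mult_ac)
  qed
  from \<open>is_poly I f\<close> show ?thesis
  proof (induction rule: is_poly_induct)
    case zero
    show ?case by (rule assms(3))
  next
    case (step c l f)
    then show ?case using *[of l _ 0] by (simp add: lin is_poly_monomial)
  qed
qed

section \<open>Directional derivatives\<close>

definition dir_deriv :: "('i \<Rightarrow> real) \<Rightarrow> (('i \<Rightarrow> real) \<Rightarrow> real) \<Rightarrow> ('i \<Rightarrow> real) \<Rightarrow> real" where
  "dir_deriv v f x = deriv (\<lambda>t. f (\<lambda>k. x k + t * v k)) 0"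

lemma dir_deriv_eqI:
  "((\<lambda>t. f (\<lambda>k. x k + t * v k)) has_field_derivative y) (at 0) \<Longrightarrow> dir_deriv v f x = y"
  by (simp add: dir_deriv_def DERIV_imp_deriv)

lemma has_dir_deriv:
  assumes "is_poly I f"
  shows "((\<lambda>t. f (\<lambda>k. x k + t * v k)) has_field_derivative dir_deriv v f x) (at 0)"
proof -
  have dir_deriv_monomial: "(\<lambda>t. monomial l (\<lambda>k. x k + t * v k)) field_differentiable at 0" for l
    by (induction l) (auto intro!: derivative_intros)
  from assms have "(\<lambda>t. f (\<lambda>k. x k + t * v k)) field_differentiable at 0"
    by (induction rule: is_poly_induct) (auto intro!: derivative_intros dir_deriv_monomial)
  then show ?thesis
    by (simp add: dir_deriv_def field_differentiable_derivI)
qed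

lemma dir_deriv_const [simp]: "dir_deriv v (\<lambda>x. c) = (\<lambda>x. 0)"
  by (simp add: dir_deriv_def fun_eq_iff)

lemma dir_deriv_coord [simp]: "dir_deriv v (\<lambda>x. x i) = (\<lambda>x. v i)"
  by (rule ext, rule dir_deriv_eqI) (auto intro!: derivative_eq_intros)

lemma dir_deriv_lin:
  "is_poly I f \<Longrightarrow> is_poly I g \<Longrightarrow>
     dir_deriv v (\<lambda>x. c * f x + g x) = (\<lambda>x. c * dir_deriv v f x + dir_deriv v g x)"
  by (rule ext, rule dir_deriv_eqI) (auto intro!: derivative_eq_intros has_dir_deriv)

lemma dir_deriv_diff:
  "is_poly I f \<Longrightarrow> is_poly I g \<Longrightarrow> dir_deriv v (\<lambda>x. f x - g x) = (\<lambda>x. dir_deriv v f x - dir_deriv v g x)"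
  using dir_deriv_lin[of I g f v "-1"] by simp

lemma dir_deriv_mult:
  "is_poly I f \<Longrightarrow> is_poly I g \<Longrightarrow>
     dir_deriv v (\<lambda>x. f x * g x) = (\<lambda>x. dir_deriv v f x * g x + f x * dir_deriv v g x)"
  by (rule ext, rule dir_deriv_eqI) (auto intro!: derivative_eq_intros has_dir_deriv)

lemma dir_deriv_power:
  "is_poly I f \<Longrightarrow> dir_deriv v (\<lambda>x. f x ^ n) = (\<lambda>x. of_nat n * f x ^ (n - 1) * dir_deriv v f x)"
  by (rule ext, rule dir_deriv_eqI) (auto intro!: derivative_eq_intros has_dir_deriv)

lemma dir_deriv_coord_mult:
  "is_poly I f \<Longrightarrow> i \<in> I \<Longrightarrow> dir_deriv v (\<lambda>x. x i * f x) = (\<lambda>x. v i * f x + x i * dir_deriv v f x)"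
  using dir_deriv_mult[OF is_poly_coord, of i I f v] by simp

lemma poly_lt_dir_deriv:
  assumes "poly_lt I (Suc n) f"
  shows "poly_lt I n (dir_deriv v f)"
proof -
  have dir_deriv_monomial: "poly_lt I (length l) (dir_deriv v (monomial l))" if "set l \<subseteq> I" for l
    using that
  proof (induction l)
    case Nil
    have "monomial [] = (\<lambda>x. 1)" by (simp add: fun_eq_iff)
    then show ?case by (simp add: poly_lt.zero)
  next
    case (Cons k l)
    have "monomial (k # l) = (\<lambda>x. x k * monomial l x)" by (simp add: fun_eq_iff)
    then have "dir_deriv v (monomial (k # l)) = (\<lambda>x. v k * monomial l x + x k * dir_deriv v (monomial l) x)"
      using Cons.prems by (simp add: dir_deriv_coord_mult[of I] is_poly_monomial)
    moreover have "poly_lt I (Suc (length l)) (\<lambda>x. v k * monomial l x + x k * dir_deriv v (monomial l) x)"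
      using Cons by (auto intro!: poly_lt_add poly_lt_scale poly_lt_coord_mult poly_lt_monomial)
    ultimately show ?case by (simp only: length_Cons)
  qed
  from assms show ?thesis
  proof induction
    case zero
    show ?case by (simp add: poly_lt.zero)
  next
    case (step f l c)
    have "poly_lt I n (dir_deriv v (monomial l))"
      using poly_lt_weaken[OF dir_deriv_monomial[OF step.hyps(2)]] step.hyps(3) by simp
    from poly_lt_lin[OF this step.IH, of c] show ?case
      using step.hyps by (simp add: dir_deriv_lin[OF is_poly_monomial is_polyI])
  qed
qed

lemma is_poly_dir_deriv [intro]: "is_poly I f \<Longrightarrow> is_poly I (dir_deriv v f)"
  by (metis is_poly_def poly_lt_dir_deriv poly_lt_weaken le_SucI order_refl)

lemma dir_deriv_commute:
  assumes "is_poly I f"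
  shows "dir_deriv u (dir_deriv v f) = dir_deriv v (dir_deriv u f)"
proof -
  have dir_deriv_monomial: "dir_deriv u (dir_deriv v (monomial l)) = dir_deriv v (dir_deriv u (monomial l))" if "set l \<subseteq> I" for l
    using that
  proof (induction l)
    case Nil
    have "monomial [] = (\<lambda>x. 1)" by (simp add: fun_eq_iff)
    then show ?case by simp
  next
    case (Cons k l)
    then have [simp]: "is_poly I (monomial l)" "is_poly I (dir_deriv w (monomial l))" "k \<in> I" for w
      by auto
    have "monomial (k # l) = (\<lambda>x. x k * monomial l x)" by (simp add: fun_eq_iff)
    moreover have "dir_deriv w (dir_deriv z (\<lambda>x. x k * monomial l x)) =
        (\<lambda>x. z k * dir_deriv w (monomial l) x + (w k * dir_deriv z (monomial l) x + x k * dir_deriv w (dir_deriv z (monomial l)) x))"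
      for w z
      by (simp add: dir_deriv_coord_mult[of I] dir_deriv_lin[of I] is_poly_mult is_poly_coord)
    ultimately show ?case using Cons by (simp add: algebra_simps)
  qed
  from assms show ?thesis
  proof (induction rule: is_poly_induct)
    case zero
    show ?case by simp
  next
    case (step c l f)
    then show ?case
      by (simp add: dir_deriv_lin[of I] is_poly_monomial is_poly_dir_deriv dir_deriv_monomial)
  qed
qed

section \<open>Gaussian families and Stein's formula\<close>

lemma sum_monomials_has_derivative_at_0:
  fixes c :: "nat \<Rightarrow> real"
  assumes "\<And>t. h t = (\<Sum>j\<le>n. c j * t ^ j)" "n \<ge> 1"
  shows "(h has_field_derivative c 1) (at 0)"
proof -
  have "((\<lambda>t. \<Sum>j\<le>n. c j * t ^ j) has_field_derivative (\<Sum>j\<le>n. c j * (of_nat j * 0 ^ (j - 1)))) (at 0)"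
    by (auto intro!: derivative_eq_intros simp: mult_ac)
  also have "(\<Sum>j\<le>n. c j * (of_nat j * 0 ^ (j - 1))) = (\<Sum>j\<le>n. if j = 1 then c 1 else 0)"
    by (intro sum.cong) (auto simp: power_0_left)
  also have "\<dots> = c 1" using assms(2) by simp
  finally show ?thesis using ext[of h, OF assms(1)] by (simp only:)
qed

text \<open>
  The Gaussian hypothesis enters only through the moments of linear combinations. The
  recursion is that of the centered normal law; it is stated with the second moment of the
  combination itself, so it also covers degenerate combinations and singular covariance.
\<close>

locale gaussian_family = prob_space M for M :: "'a measure" +
  fixes I :: "'i set" and G :: "'i \<Rightarrow> 'a \<Rightarrow> real"
  assumes finite_I: "finite I"
    and measurable_G: "\<And>i. i \<in> I \<Longrightarrow> G i \<in> borel_measurable M"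
    and centered: "\<And>i. i \<in> I \<Longrightarrow> expectation (G i) = 0"
    and integrable_lin_power: "\<And>a n. integrable M (\<lambda>\<omega>. (\<Sum>i\<in>I. a i * G i \<omega>) ^ n)"
    and moment_rec: "\<And>a n. expectation (\<lambda>\<omega>. (\<Sum>i\<in>I. a i * G i \<omega>) ^ (n + 2)) =
      (real n + 1) * expectation (\<lambda>\<omega>. (\<Sum>i\<in>I. a i * G i \<omega>) ^ 2)
                   * expectation (\<lambda>\<omega>. (\<Sum>i\<in>I. a i * G i \<omega>) ^ n)"
begin

definition gexpect :: "(('i \<Rightarrow> real) \<Rightarrow> real) \<Rightarrow> real" where
  "gexpect f = expectation (\<lambda>\<omega>. f (\<lambda>i. G i \<omega>))"

definition cov :: "'i \<Rightarrow> 'i \<Rightarrow> real" where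
  "cov i j = gexpect (\<lambda>x. x i * x j)"

lemma integrable_coord_power:
  assumes "i \<in> I"
  shows "integrable M (\<lambda>\<omega>. G i \<omega> ^ n)"
proof -
  have "(\<Sum>j\<in>I. (if j = i then 1 else 0) * G j \<omega>) = G i \<omega>" for \<omega>
    using assms finite_I by (simp add: if_distrib[of "\<lambda>t. t * _"] cong: if_cong)
  then show ?thesis
    using integrable_lin_power[of "\<lambda>j. if j = i then 1 else 0" n] by simp
qed

lemma measurable_monomial:
  "set l \<subseteq> I \<Longrightarrow> (\<lambda>\<omega>. monomial l (\<lambda>i. G i \<omega>)) \<in> borel_measurable M"
  by (induction l) (auto intro!: borel_measurable_times measurable_G)

text \<open>
  A product of functions all of whose powers are integrable has the same property, by
  \<open>\<bar>a b\<bar> \<le> a\<^sup>2 + b\<^sup>2\<close>. This is why all powers are carried through the induction.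
\<close>

lemma integrable_monomial_power:
  assumes "set l \<subseteq> I"
  shows "integrable M (\<lambda>\<omega>. monomial l (\<lambda>i. G i \<omega>) ^ n)"
  using assms
proof (induction l arbitrary: n)
  case Nil
  then show ?case by simp
next
  case (Cons k l)
  let ?m = "\<lambda>\<omega>. monomial l (\<lambda>i. G i \<omega>)"
  have dom: "integrable M (\<lambda>\<omega>. G k \<omega> ^ (2 * n) + ?m \<omega> ^ (2 * n))"
    using Cons by (auto intro!: Bochner_Integration.integrable_add integrable_coord_power)
  have ab: "\<bar>a * b\<bar> \<le> a\<^sup>2 + b\<^sup>2" for a b :: real
    using sum_squares_bound[of "\<bar>a\<bar>" "\<bar>b\<bar>"] mult_nonneg_nonneg[of "\<bar>a\<bar>" "\<bar>b\<bar>"]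
    unfolding abs_mult by (simp only: power2_abs) linarith
  show ?case
  proof (rule Bochner_Integration.integrable_bound[OF dom])
    show "(\<lambda>\<omega>. monomial (k # l) (\<lambda>i. G i \<omega>) ^ n) \<in> borel_measurable M"
      using measurable_monomial[OF Cons.prems] by (rule borel_measurable_power)
    show "AE \<omega> in M. norm (monomial (k # l) (\<lambda>i. G i \<omega>) ^ n)
            \<le> norm (G k \<omega> ^ (2 * n) + ?m \<omega> ^ (2 * n))"
    proof (rule AE_I2)
      fix \<omega>
      have "norm (monomial (k # l) (\<lambda>i. G i \<omega>) ^ n) \<le> (G k \<omega> ^ n)\<^sup>2 + (?m \<omega> ^ n)\<^sup>2"
        using ab[of "G k \<omega> ^ n" "?m \<omega> ^ n"] by (simp add: power_mult_distrib)
      also have "\<dots> = G k \<omega> ^ (2 * n) + ?m \<omega> ^ (2 * n)"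
        by (simp add: power_mult[symmetric] mult.commute)
      finally show "norm (monomial (k # l) (\<lambda>i. G i \<omega>) ^ n)
            \<le> norm (G k \<omega> ^ (2 * n) + ?m \<omega> ^ (2 * n))" by simp
    qed
  qed
qed

lemma integrable_poly:
  assumes "is_poly I f"
  shows "integrable M (\<lambda>\<omega>. f (\<lambda>i. G i \<omega>))"
  using assms
proof (induction rule: is_poly_induct)
  case zero
  show ?case by simp
next
  case (step c l f)
  then show ?case using integrable_monomial_power[of l 1] by simp
qed

lemma gexpect_lin:
  "is_poly I f \<Longrightarrow> is_poly I g \<Longrightarrow> gexpect (\<lambda>x. c * f x + g x) = c * gexpect f + gexpect g"
  by (simp add: gexpect_def integrable_poly)

lemma gexpect_add: "is_poly I f \<Longrightarrow> is_poly I g \<Longrightarrow> gexpect (\<lambda>x. f x + g x) = gexpect f + gexpect g"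
  by (simp add: gexpect_def integrable_poly)

lemma gexpect_diff: "is_poly I f \<Longrightarrow> is_poly I g \<Longrightarrow> gexpect (\<lambda>x. f x - g x) = gexpect f - gexpect g"
  by (simp add: gexpect_def integrable_poly)

lemma gexpect_cmult: "gexpect (\<lambda>x. c * f x) = c * gexpect f"
  by (simp add: gexpect_def)

lemma gexpect_zero: "gexpect (\<lambda>x. 0) = 0"
  by (simp add: gexpect_def)

lemma gexpect_const: "gexpect (\<lambda>x. c) = c"
  by (simp add: gexpect_def prob_space)

lemma gexpect_square_nonneg: "0 \<le> gexpect (\<lambda>x. f x * f x)"
  by (simp add: gexpect_def)

lemma gexpect_sum:
  assumes "finite J" "\<And>j. j \<in> J \<Longrightarrow> is_poly I (f j)"
  shows "gexpect (\<lambda>x. \<Sum>j\<in>J. c j * f j x) = (\<Sum>j\<in>J. c j * gexpect (f j))"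
  by (rule linear_functional_sum[OF gexpect_lin gexpect_zero assms])

lemma is_poly_linear: "is_poly I (\<lambda>x. \<Sum>j\<in>I. a j * x j)"
  by (intro is_poly_sum is_poly_mult is_poly_const is_poly_coord)

text \<open>
  By the binomial formula the expectation is a polynomial in \<open>t\<close>, so no differentiation under
  the integral is involved.
\<close>

lemma perturbed_power_has_derivative:
  fixes a :: "'i \<Rightarrow> real"
  assumes "i \<in> I"
  defines "Y \<equiv> \<lambda>x. \<Sum>j\<in>I. a j * x j"
  shows "((\<lambda>t. gexpect (\<lambda>x. (t * x i + Y x) ^ n)) has_field_derivative
           real n * gexpect (\<lambda>x. x i * Y x ^ (n - 1))) (at 0)"
proof (cases "n = 0")
  case True
  then show ?thesis by simp
next
  case False
  have "is_poly I Y" unfolding Y_def by (rule is_poly_linear)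
  then have poly: "is_poly I (\<lambda>x. x i ^ j * Y x ^ (n - j))" for j
    using assms(1) by (intro is_poly_mult is_poly_power is_poly_coord)
  have "gexpect (\<lambda>x. (t * x i + Y x) ^ n) =
          (\<Sum>j\<le>n. (real (n choose j) * gexpect (\<lambda>x. x i ^ j * Y x ^ (n - j))) * t ^ j)" for t
  proof -
    have "gexpect (\<lambda>x. (t * x i + Y x) ^ n) =
        gexpect (\<lambda>x. \<Sum>j\<le>n. (real (n choose j) * t ^ j) * (x i ^ j * Y x ^ (n - j)))"
      unfolding binomial_ring by (simp only: power_mult_distrib mult_ac)
    also have "\<dots> = (\<Sum>j\<le>n. (real (n choose j) * t ^ j) * gexpect (\<lambda>x. x i ^ j * Y x ^ (n - j)))"
      by (rule gexpect_sum) (use poly in auto)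
    finally show ?thesis by (simp only: mult_ac)
  qed
  from sum_monomials_has_derivative_at_0[OF this] False show ?thesis by simp
qed

lemma moment_rec_perturbed:
  fixes a :: "'i \<Rightarrow> real"
  assumes "i \<in> I"
  defines "Y \<equiv> \<lambda>x. \<Sum>j\<in>I. a j * x j"
  shows "gexpect (\<lambda>x. (t * x i + Y x) ^ (n + 2)) =
    (real n + 1) * gexpect (\<lambda>x. (t * x i + Y x) ^ 2) * gexpect (\<lambda>x. (t * x i + Y x) ^ n)"
proof -
  define b where "b = (\<lambda>j. a j + (if j = i then t else 0))"
  have "t * x i + Y x = (\<Sum>j\<in>I. b j * x j)" for x
    using assms(1) finite_I
    by (simp add: Y_def b_def algebra_simps sum.distrib if_distrib[of "\<lambda>t. _ * t"] cong: if_cong)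
  then show ?thesis using moment_rec[of b n] by (simp add: gexpect_def)
qed

text \<open>
  For \<open>Y\<close> replaced by \<open>Y + t x\<^sub>i\<close>, the moment recursion is an identity between functions of \<open>t\<close>.
  Its derivative at \<open>t = 0\<close> expresses \<open>E[x\<^sub>i Y^(m+2)]\<close> through \<open>E[x\<^sub>i Y^m]\<close>, \<open>E[x\<^sub>i Y]\<close> and moments
  of \<open>Y\<close>, which yields the formula by induction in steps of two.
\<close>

lemma stein_linear_power:
  fixes a :: "'i \<Rightarrow> real"
  assumes "i \<in> I"
  defines "Y \<equiv> \<lambda>x. \<Sum>j\<in>I. a j * x j"
  shows "gexpect (\<lambda>x. x i * Y x ^ n) = real n * gexpect (\<lambda>x. x i * Y x) * gexpect (\<lambda>x. Y x ^ (n - 1))"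
proof (induction n rule: less_induct)
  case (less n)
  consider "n = 0" | "n = 1" | m where "n = m + 2"
    by (metis One_nat_def add_2_eq_Suc' not0_implies_Suc)
  then show ?case
  proof cases
    case 1
    then show ?thesis using centered[OF assms(1)] by (simp add: gexpect_def)
  next
    case 2
    then show ?thesis by (simp add: gexpect_const)
  next
    case 3
    define e where "e k = gexpect (\<lambda>x. Y x ^ k)" for k
    define c where "c = gexpect (\<lambda>x. x i * Y x)"
    define h where "h k t = gexpect (\<lambda>x. (t * x i + Y x) ^ k)" for k t
    have h0: "h k 0 = e k" for k by (simp add: h_def e_def)
    have deriv: "(h k has_field_derivative real k * gexpect (\<lambda>x. x i * Y x ^ (k - 1))) (at 0)" for k
      unfolding h_def Y_def by (rule perturbed_power_has_derivative[OF assms(1)])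
    have rec: "h (k + 2) t = (real k + 1) * h 2 t * h k t" for k t
      unfolding h_def Y_def by (rule moment_rec_perturbed[OF assms(1)])
    have "(h (m + 1 + 2) has_field_derivative
        (real (m + 1) + 1) * (2 * c) * h (m + 1) 0
        + (real (m + 1) * gexpect (\<lambda>x. x i * Y x ^ m)) * ((real (m + 1) + 1) * h 2 0)) (at 0)"
    proof -
      have "((\<lambda>t. (real (m + 1) + 1) * h 2 t * h (m + 1) t) has_field_derivative
        (real (m + 1) + 1) * (2 * c) * h (m + 1) 0
        + (real (m + 1) * gexpect (\<lambda>x. x i * Y x ^ m)) * ((real (m + 1) + 1) * h 2 0)) (at 0)"
        using deriv[of 2] deriv[of "m + 1"]
        by (auto intro!: derivative_eq_intros simp: c_def)
      then show ?thesis using ext[of "h (m + 1 + 2)", OF rec[of "m + 1"]] by (simp only:)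
    qed
    from DERIV_unique[OF deriv this]
    have "real (m + 3) * gexpect (\<lambda>x. x i * Y x ^ (m + 2)) =
        real (m + 2) * (2 * c) * e (m + 1) + real (m + 1) * gexpect (\<lambda>x. x i * Y x ^ m) * (real (m + 2) * e 2)"
      by (simp add: h0 eval_nat_numeral)
    also have "gexpect (\<lambda>x. x i * Y x ^ m) = real m * c * e (m - 1)"
      using less.IH[of m] 3 by (simp add: c_def e_def)
    also have "real (m + 1) * (real m * c * e (m - 1)) * (real (m + 2) * e 2) =
        real (m + 1) * real (m + 2) * c * e (m + 1)"
    proof (cases m)
      case 0
      have "e 1 = 0"
      proof -
        have "e 1 = (\<Sum>j\<in>I. a j * gexpect (\<lambda>x. x j))"
          unfolding e_def Y_def using finite_I by (subst gexpect_sum[symmetric]) auto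
        also have "\<dots> = 0" using centered by (simp add: gexpect_def)
        finally show ?thesis .
      qed
      then show ?thesis using 0 by simp
    next
      case (Suc k)
      have "e (m + 1) = (real k + 1) * e 2 * e k"
        using rec[of k 0] Suc by (simp add: h0)
      then show ?thesis using Suc by (simp add: algebra_simps)
    qed
    finally have "real (m + 3) * gexpect (\<lambda>x. x i * Y x ^ (m + 2)) = real (m + 3) * (real (m + 2) * c * e (m + 1))"
      by (simp add: algebra_simps)
    then have "gexpect (\<lambda>x. x i * Y x ^ (m + 2)) = real (m + 2) * c * e (m + 1)" by (simp del: of_nat_add)
    then show ?thesis using 3 by (simp add: c_def e_def)
  qed
qed

text \<open>
  Gaussian integration by parts. Both sides are linear in \<open>f\<close> and agree on powers of linear
  forms, hence on all polynomials. The derivative in direction \<open>cov i\<close> plays the part of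
  \<open>\<Sum>\<^sub>j cov i j \<partial>\<^sub>j\<close>.
\<close>

lemma stein:
  assumes "i \<in> I" "is_poly I f"
  shows "gexpect (\<lambda>x. x i * f x) = gexpect (dir_deriv (cov i) f)"
proof -
  define B where "B f = gexpect (\<lambda>x. x i * f x) - gexpect (dir_deriv (cov i) f)" for f
  have "B f = 0"
  proof (rule functional_vanishing_on_powers[OF finite_I _ _ _ assms(2)])
    fix c and f g :: "('i \<Rightarrow> real) \<Rightarrow> real"
    assume fg: "is_poly I f" "is_poly I g"
    have "gexpect (\<lambda>x. x i * (c * f x + g x)) = gexpect (\<lambda>x. c * (x i * f x) + x i * g x)"
      by (simp add: algebra_simps)
    also have "\<dots> = c * gexpect (\<lambda>x. x i * f x) + gexpect (\<lambda>x. x i * g x)"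
      using fg assms(1) by (intro gexpect_lin is_poly_mult is_poly_coord)
    finally show "B (\<lambda>x. c * f x + g x) = c * B f + B g"
      unfolding B_def dir_deriv_lin[OF fg] using fg
      by (simp add: gexpect_lin is_poly_dir_deriv right_diff_distrib)
  next
    show "B (\<lambda>x. 0) = 0" by (simp add: B_def gexpect_zero)
  next
    fix a :: "'i \<Rightarrow> real" and n :: nat
    let ?Y = "\<lambda>x :: 'i \<Rightarrow> real. \<Sum>j\<in>I. a j * x j"
    have "gexpect (\<lambda>x. x i * ?Y x) = gexpect (\<lambda>x. \<Sum>j\<in>I. a j * (x i * x j))"
      by (simp add: sum_distrib_left mult_ac)
    also have "\<dots> = (\<Sum>j\<in>I. a j * cov i j)"
      unfolding cov_def using assms(1) finite_I by (intro gexpect_sum is_poly_mult is_poly_coord)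
    finally have "gexpect (\<lambda>x. x i * ?Y x) = (\<Sum>j\<in>I. a j * cov i j)" .
    moreover have "dir_deriv (cov i) ?Y = (\<lambda>x. \<Sum>j\<in>I. a j * cov i j)"
      by (rule ext, rule dir_deriv_eqI) (auto intro!: derivative_eq_intros simp: mult.commute)
    ultimately have "gexpect (dir_deriv (cov i) (\<lambda>x. ?Y x ^ n)) =
        gexpect (\<lambda>x. (real n * gexpect (\<lambda>x. x i * ?Y x)) * ?Y x ^ (n - 1))"
      unfolding dir_deriv_power[OF is_poly_linear] by (simp only: mult_ac)
    also have "\<dots> = gexpect (\<lambda>x. x i * ?Y x ^ n)"
      unfolding gexpect_cmult stein_linear_power[OF assms(1)] by (rule refl)
    finally show "B (\<lambda>x. ?Y x ^ n) = 0" by (simp add: B_def)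
  qed
  then show ?thesis by (simp add: B_def)
qed

section \<open>Wick products and their norms\<close>

text \<open>
  The creation operator of the coordinate \<open>i\<close>: multiplication by \<open>x\<^sub>i\<close>, corrected so that it
  becomes the adjoint of the derivative in direction \<open>cov i\<close>.
\<close>

definition wick :: "'i \<Rightarrow> (('i \<Rightarrow> real) \<Rightarrow> real) \<Rightarrow> ('i \<Rightarrow> real) \<Rightarrow> real" where
  "wick i f x = x i * f x - dir_deriv (cov i) f x"

definition ip :: "(('i \<Rightarrow> real) \<Rightarrow> real) \<Rightarrow> (('i \<Rightarrow> real) \<Rightarrow> real) \<Rightarrow> real" where
  "ip f g = gexpect (\<lambda>x. f x * g x)"

lemma is_poly_wick [intro]: "i \<in> I \<Longrightarrow> is_poly I f \<Longrightarrow> is_poly I (wick i f)"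
  unfolding wick_def[abs_def] by (intro is_poly_diff is_poly_mult is_poly_coord is_poly_dir_deriv)

lemma ip_commute: "ip f g = ip g f"
  by (simp add: ip_def mult.commute)

lemma ip_self_nonneg: "0 \<le> ip f f"
  by (simp add: ip_def gexpect_square_nonneg)

lemma ip_lin_right:
  assumes "is_poly I f" "is_poly I g" "is_poly I h"
  shows "ip h (\<lambda>x. c * f x + g x) = c * ip h f + ip h g"
proof -
  have "ip h (\<lambda>x. c * f x + g x) = gexpect (\<lambda>x. c * (h x * f x) + h x * g x)"
    unfolding ip_def by (simp add: algebra_simps)
  then show ?thesis
    using assms by (simp add: ip_def gexpect_lin is_poly_mult)
qed

lemma wick_adjoint:
  assumes "i \<in> I" "is_poly I f" "is_poly I g"
  shows "ip (wick i f) g = ip f (dir_deriv (cov i) g)"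
proof -
  have "gexpect (\<lambda>x. x i * (f x * g x)) = gexpect (\<lambda>x. dir_deriv (cov i) f x * g x + f x * dir_deriv (cov i) g x)"
    using assms by (simp only: stein is_poly_mult dir_deriv_mult)
  also have "\<dots> = gexpect (\<lambda>x. dir_deriv (cov i) f x * g x) + ip f (dir_deriv (cov i) g)"
    unfolding ip_def using assms by (intro gexpect_add is_poly_mult is_poly_dir_deriv)
  finally have "gexpect (\<lambda>x. x i * (f x * g x)) - gexpect (\<lambda>x. dir_deriv (cov i) f x * g x) = ip f (dir_deriv (cov i) g)"
    by simp
  moreover have "ip (wick i f) g = gexpect (\<lambda>x. x i * (f x * g x) - dir_deriv (cov i) f x * g x)"
    unfolding ip_def wick_def by (simp add: algebra_simps)
  moreover have "\<dots> = gexpect (\<lambda>x. x i * (f x * g x)) - gexpect (\<lambda>x. dir_deriv (cov i) f x * g x)"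
    using assms by (intro gexpect_diff is_poly_mult is_poly_coord is_poly_dir_deriv)
  ultimately show ?thesis by simp
qed

lemma dir_deriv_wick:
  assumes "i \<in> I" "is_poly I f"
  shows "dir_deriv v (wick i f) = (\<lambda>x. v i * f x + wick i (dir_deriv v f) x)"
proof -
  have "dir_deriv v (wick i f) = (\<lambda>x. v i * f x + x i * dir_deriv v f x - dir_deriv v (dir_deriv (cov i) f) x)"
    unfolding wick_def[abs_def] using assms
    by (simp add: dir_deriv_diff[of I] dir_deriv_coord_mult[of I] is_poly_mult is_poly_coord is_poly_dir_deriv)
  then show ?thesis
    by (simp add: wick_def dir_deriv_commute[OF assms(2), of v] add_diff_eq)
qed

lemma wick_lin:
  assumes "is_poly I f" "is_poly I g"
  shows "wick i (\<lambda>x. c * f x + g x) = (\<lambda>x. c * wick i f x + wick i g x)"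
  by (simp add: fun_eq_iff wick_def dir_deriv_lin[OF assms] right_diff_distrib distrib_left mult.left_commute)

lemma is_poly_wick_power: "i \<in> I \<Longrightarrow> is_poly I f \<Longrightarrow> is_poly I ((wick i ^^ n) f)"
  by (induction n) auto

lemma dir_deriv_wick_power:
  assumes "i \<in> I" "is_poly I f"
  shows "dir_deriv v ((wick i ^^ Suc n) f) =
    (\<lambda>x. (real (Suc n) * v i) * (wick i ^^ n) f x + (wick i ^^ Suc n) (dir_deriv v f) x)"
proof (induction n)
  case 0
  show ?case by (simp add: dir_deriv_wick[OF assms])
next
  case (Suc n)
  have p: "is_poly I ((wick i ^^ n) f)" for n
    by (rule is_poly_wick_power[OF assms])
  have p': "is_poly I ((wick i ^^ n) (dir_deriv v f))" for n
    using assms by (intro is_poly_wick_power is_poly_dir_deriv)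
  have "dir_deriv v ((wick i ^^ Suc (Suc n)) f) =
      (\<lambda>x. v i * (wick i ^^ Suc n) f x + wick i (dir_deriv v ((wick i ^^ Suc n) f)) x)"
    using dir_deriv_wick[OF assms(1) p[of "Suc n"]] by simp
  also have "wick i (dir_deriv v ((wick i ^^ Suc n) f)) =
      (\<lambda>x. (real (Suc n) * v i) * (wick i ^^ Suc n) f x + (wick i ^^ Suc (Suc n)) (dir_deriv v f) x)"
    unfolding Suc.IH wick_lin[OF p p'] by simp
  finally show ?case by (simp add: algebra_simps)
qed

text \<open>
  This is the error term in the lower bound for \<open>\<parallel>A^(n+1) f\<parallel>\<^sup>2\<close>, with \<open>A = wick i\<close> and
  \<open>D = dir_deriv (cov i)\<close>. Moving one \<open>A\<close> across the inner product and commuting the resulting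
  \<open>D\<close> past the other factors shows that the value \<open>b\<^sub>n\<close> satisfies
  \<open>b\<^sub>n\<^sub>+\<^sub>1 = (n + 1) b\<^sub>n + \<parallel>A^(n+1) D f\<parallel>\<^sup>2\<close> with \<open>b\<^sub>0 = \<parallel>D f\<parallel>\<^sup>2\<close>.
\<close>

lemma wick_power_ip_dir_deriv_nonneg:
  assumes "i \<in> I" "cov i i = 1" "is_poly I f"
  shows "0 \<le> ip ((wick i ^^ n) f) ((wick i ^^ Suc n) (dir_deriv (cov i) f))"
proof (induction n)
  case 0
  have "ip f (wick i (dir_deriv (cov i) f)) = ip (dir_deriv (cov i) f) (dir_deriv (cov i) f)"
    using assms by (subst ip_commute) (simp add: wick_adjoint is_poly_dir_deriv)
  then show ?case by (simp add: ip_self_nonneg)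
next
  case (Suc n)
  let ?D = "dir_deriv (cov i)"
  let ?A = "\<lambda>n. (wick i ^^ n)"
  have p: "is_poly I (?A n f)" "is_poly I (?A n (?D f))" for n
    using assms by (auto intro: is_poly_wick_power)
  have "ip (?A (Suc n) f) (?A (Suc (Suc n)) (?D f)) = ip (wick i (?A (Suc n) (?D f))) (?A (Suc n) f)"
    by (simp add: ip_commute)
  also have "\<dots> = ip (?A (Suc n) (?D f)) (?D (?A (Suc n) f))"
    by (rule wick_adjoint[OF assms(1) p(2) p(1)])
  also have "\<dots> = real (Suc n) * ip (?A (Suc n) (?D f)) (?A n f) + ip (?A (Suc n) (?D f)) (?A (Suc n) (?D f))"
    unfolding dir_deriv_wick_power[OF assms(1,3)] assms(2) ip_lin_right[OF p(1) p(2) p(2)] by simp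
  finally show ?case
    using Suc.IH ip_self_nonneg[of "?A (Suc n) (?D f)"] by (simp add: ip_commute)
qed

text \<open>
  The commutation rule \<open>D A^(n+1) = (n + 1) A^n + A^(n+1) D\<close> turns \<open>\<parallel>A^(n+1) f\<parallel>\<^sup>2\<close> into
  \<open>(n + 1) \<parallel>A^n f\<parallel>\<^sup>2\<close> plus the nonnegative term above. That term
  vanishes when \<open>f\<close> depends only on coordinates uncorrelated with \<open>i\<close>.
\<close>

lemma wick_power_norm:
  assumes "i \<in> I" "cov i i = 1" "is_poly I f"
  shows "fact n * ip f f \<le> ip ((wick i ^^ n) f) ((wick i ^^ n) f)"
proof (induction n)
  case 0
  show ?case by simp
next
  case (Suc n)
  let ?D = "dir_deriv (cov i)"
  let ?A = "\<lambda>n. (wick i ^^ n)"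
  have p: "is_poly I (?A n f)" "is_poly I (?A n (?D f))" for n
    using assms by (auto intro: is_poly_wick_power)
  have "ip (?A (Suc n) f) (?A (Suc n) f) = ip (?A n f) (?D (?A (Suc n) f))"
    using wick_adjoint[OF assms(1) p(1)[of n] p(1)[of "Suc n"]] by simp
  also have "\<dots> = real (Suc n) * ip (?A n f) (?A n f) + ip (?A n f) (?A (Suc n) (?D f))"
    unfolding dir_deriv_wick_power[OF assms(1,3)] assms(2) ip_lin_right[OF p(1) p(2) p(1)] by simp
  also have "\<dots> \<ge> real (Suc n) * (fact n * ip f f)"
    using wick_power_ip_dir_deriv_nonneg[OF assms, of n] Suc.IH
    by (intro order_trans[OF mult_left_mono[OF Suc.IH]]) auto
  finally show ?case by (simp add: algebra_simps)
qed

definition wick_monomial :: "'i list \<Rightarrow> ('i \<Rightarrow> real) \<Rightarrow> real" where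
  "wick_monomial l = foldr wick l (\<lambda>x. 1)"

lemma wick_monomial_Nil [simp]: "wick_monomial [] = (\<lambda>x. 1)"
  and wick_monomial_Cons [simp]: "wick_monomial (k # l) = wick k (wick_monomial l)"
  and wick_monomial_block:
    "wick_monomial (replicate n k @ l) = (wick k ^^ n) (wick_monomial l)"
proof -
  show "wick_monomial (replicate n k @ l) = (wick k ^^ n) (wick_monomial l)"
    by (induction n) (simp_all add: wick_monomial_def)
qed (simp_all add: wick_monomial_def)

lemma is_poly_wick_monomial: "set l \<subseteq> I \<Longrightarrow> is_poly I (wick_monomial l)"
  by (induction l) auto

text \<open>
  The creation operator differs from multiplication by a coordinate only by a derivative, which
  has lower degree.
\<close>

lemma wick_monomial_leading:
  assumes "set l \<subseteq> I"
  shows "poly_lt I (length l) (\<lambda>x. monomial l x - wick_monomial l x)"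
  using assms
proof (induction l)
  case Nil
  show ?case by (simp add: poly_lt.zero)
next
  case (Cons k l)
  let ?R = "wick_monomial l"
  let ?E = "\<lambda>x. monomial l x - ?R x"
  have k: "k \<in> I" and E: "poly_lt I (length l) ?E" using Cons by auto
  have "poly_lt I (Suc (length l)) (\<lambda>x. monomial l x - ?E x)"
    using Cons.prems by (intro poly_lt_diff poly_lt_monomial poly_lt_weaken[OF E]) auto
  then have "poly_lt I (Suc (length l)) ?R" by simp
  then have "poly_lt I (Suc (length l)) (dir_deriv (cov k) ?R)"
    by (rule poly_lt_weaken[OF poly_lt_dir_deriv]) simp
  with poly_lt_coord_mult[OF E k]
  have "poly_lt I (Suc (length l)) (\<lambda>x. x k * ?E x + dir_deriv (cov k) ?R x)"
    by (rule poly_lt_add)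
  then show ?case by (simp add: wick_def algebra_simps)
qed

text \<open>
  Moving the creation operators to the other side differentiates \<open>f\<close> as often as the word is
  long, which is more often than its degree.
\<close>

lemma wick_monomial_orthogonal:
  assumes "set l \<subseteq> I" "poly_lt I (length l) f"
  shows "ip (wick_monomial l) f = 0"
  using assms
proof (induction l arbitrary: f)
  case Nil
  from Nil(2) have "f = (\<lambda>x. 0)" by (cases rule: poly_lt.cases) auto
  then show ?case by (simp add: ip_def gexpect_zero)
next
  case (Cons k l)
  then show ?case
    by (simp add: wick_adjoint is_poly_wick_monomial is_polyI poly_lt_dir_deriv)
qed

text \<open>
  Pythagoras: \<open>f\<close> is the Wick product of its leading monomial plus a polynomial of lower degree,
  and the two are orthogonal.
\<close>

lemma wick_monomial_minimizes:
  assumes "set l \<subseteq> I" "poly_lt I (length l) (\<lambda>x. f x - monomial l x)"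
  shows "ip (wick_monomial l) (wick_monomial l) \<le> ip f f"
proof -
  let ?R = "wick_monomial l"
  let ?E = "\<lambda>x. f x - ?R x"
  have "poly_lt I (length l) (\<lambda>x. (f x - monomial l x) + (monomial l x - ?R x))"
    by (rule poly_lt_add[OF assms(2) wick_monomial_leading[OF assms(1)]])
  then have E: "poly_lt I (length l) ?E" by simp
  then have pE: "is_poly I ?E" and pR: "is_poly I ?R"
    using assms(1) by (auto intro: is_polyI is_poly_wick_monomial)
  have "ip f f = gexpect (\<lambda>x. (2 * (?R x * ?E x) + ?E x * ?E x) + ?R x * ?R x)"
    unfolding ip_def by (simp add: algebra_simps)
  also have "\<dots> = (2 * ip ?R ?E + ip ?E ?E) + ip ?R ?R"
    using is_poly_mult[OF pR pE] is_poly_mult[OF pE pE] is_poly_mult[OF pR pR]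
    by (simp only: ip_def gexpect_add gexpect_lin is_poly_lin)
  finally show ?thesis
    using wick_monomial_orthogonal[OF assms(1) E] ip_self_nonneg[of ?E] by simp
qed

lemma wick_monomial_norm:
  fixes n :: "'i \<Rightarrow> nat"
  assumes "distinct js" "set js \<subseteq> I" "\<And>j. j \<in> set js \<Longrightarrow> cov j j = 1"
  defines "w \<equiv> wick_monomial (concat (map (\<lambda>j. replicate (n j) j) js))"
  shows "(\<Prod>j\<in>set js. fact (n j)) \<le> ip w w"
  using assms(1-3) unfolding w_def
proof (induction js)
  case Nil
  show ?case by (simp add: ip_def gexpect_const)
next
  case (Cons k js)
  let ?w = "wick_monomial (concat (map (\<lambda>j. replicate (n j) j) js))"
  have sub: "set (concat (map (\<lambda>j. replicate (n j) j) js)) \<subseteq> I"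
    using Cons.prems by auto
  have "(\<Prod>j\<in>set (k # js). fact (n j)) = fact (n k) * (\<Prod>j\<in>set js. fact (n j) :: real)"
    using Cons.prems by simp
  also have "\<dots> \<le> fact (n k) * ip ?w ?w"
    using Cons by (intro mult_left_mono) auto
  also have "\<dots> \<le> ip ((wick k ^^ n k) ?w) ((wick k ^^ n k) ?w)"
    using Cons.prems by (intro wick_power_norm is_poly_wick_monomial[OF sub]) auto
  finally show ?case by (simp add: wick_monomial_block)
qed

text \<open>
  With \<open>p\<^sub>k = x\<^sub>k^n\<^sub>k + q\<close> and \<open>Q = m + e\<close>, where \<open>q\<close> and \<open>e\<close> are the lower-order parts, the error
  \<open>p\<^sub>k Q - x\<^sub>k^n\<^sub>k m = x\<^sub>k^n\<^sub>k e + q e + m q\<close> has lower degree than \<open>x\<^sub>k^n\<^sub>k m\<close>.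
\<close>

lemma prod_leading:
  fixes n :: "'i \<Rightarrow> nat"
  assumes "distinct js" "set js \<subseteq> I"
    and "\<And>j. j \<in> set js \<Longrightarrow> poly_lt I (n j) (\<lambda>x. p j x - x j ^ n j)"
  defines "l \<equiv> concat (map (\<lambda>j. replicate (n j) j) js)"
  shows "poly_lt I (length l) (\<lambda>x. (\<Prod>j\<in>set js. p j x) - monomial l x)"
  using assms(1-3) unfolding l_def
proof (induction js)
  case Nil
  show ?case by (simp add: poly_lt.zero)
next
  case (Cons k js)
  let ?l = "concat (map (\<lambda>j. replicate (n j) j) js)"
  let ?q = "\<lambda>x. p k x - x k ^ n k"
  let ?Q = "\<lambda>x. \<Prod>j\<in>set js. p j x"
  let ?E = "\<lambda>x. ?Q x - monomial ?l x"
  have mon: "monomial (replicate m k) x = x k ^ m" for m x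
    by (induction m) simp_all
  have sub: "set ?l \<subseteq> I" and k: "k \<in> I" using Cons.prems by auto
  have E: "poly_lt I (length ?l) ?E" using Cons by auto
  have q: "poly_lt I (n k) ?q" using Cons.prems by auto
  have "poly_lt I (n k + length ?l) (\<lambda>x. x k ^ n k * ?E x)"
    using poly_lt_monomial_mult[OF E, of "replicate (n k) k"] k
    by (auto simp: mon set_replicate_conv_if split: if_splits)
  moreover have "poly_lt I (n k + length ?l) (\<lambda>x. ?q x * ?E x)"
    by (rule poly_lt_mult[OF q E])
  moreover have "poly_lt I (n k + length ?l) (\<lambda>x. monomial ?l x * ?q x)"
    using poly_lt_monomial_mult[OF q sub] by (simp add: add.commute)
  ultimately have "poly_lt I (n k + length ?l)
      (\<lambda>x. (x k ^ n k * ?E x + ?q x * ?E x) + monomial ?l x * ?q x)"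
    by (intro poly_lt_add)
  moreover have "(\<lambda>x. (x k ^ n k * ?E x + ?q x * ?E x) + monomial ?l x * ?q x) =
      (\<lambda>x. p k x * ?Q x - x k ^ n k * monomial ?l x)"
    by (simp add: algebra_simps)
  ultimately show ?case
    using Cons.prems by (simp add: mon)
qed

section \<open>Lower bounds for expectations of products\<close>

text \<open>
  Equality holds when the coordinates are independent and each \<open>p\<^sub>j\<close> is the monic Hermite
  polynomial of degree \<open>n\<^sub>j\<close>. The hypothesis on \<open>p\<^sub>j\<close> says that it is monic of degree \<open>n\<^sub>j\<close> in
  \<open>x\<^sub>j\<close>, up to an arbitrary polynomial of lower degree in all the coordinates.
\<close>

theorem expectation_square_prod_ge:
  fixes n :: "'i \<Rightarrow> nat"
  assumes "J \<subseteq> I" "\<And>j. j \<in> J \<Longrightarrow> cov j j = 1"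
    and "\<And>j. j \<in> J \<Longrightarrow> poly_lt I (n j) (\<lambda>x. p j x - x j ^ n j)"
  shows "(\<Prod>j\<in>J. fact (n j)) \<le> gexpect (\<lambda>x. \<Prod>j\<in>J. (p j x)\<^sup>2)"
proof -
  obtain js where js: "set js = J" "distinct js"
    using finite_distinct_list[OF finite_subset[OF assms(1) finite_I]] by auto
  let ?l = "concat (map (\<lambda>j. replicate (n j) j) js)"
  let ?Q = "\<lambda>x. \<Prod>j\<in>set js. p j x"
  have "set ?l \<subseteq> I" using js assms(1) by auto
  moreover have "poly_lt I (length ?l) (\<lambda>x. ?Q x - monomial ?l x)"
    using js assms by (intro prod_leading) auto
  ultimately have "ip (wick_monomial ?l) (wick_monomial ?l) \<le> ip ?Q ?Q"
    by (rule wick_monomial_minimizes)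
  moreover have "(\<Prod>j\<in>set js. fact (n j)) \<le> ip (wick_monomial ?l) (wick_monomial ?l)"
    using js assms by (intro wick_monomial_norm) auto
  ultimately show ?thesis
    using js by (simp add: ip_def prod.distrib power2_eq_square)
qed

text \<open>
  The decomposition \<open>1 + x^4 = 2 x\<^sup>2 + (x\<^sup>2 - 1)\<^sup>2\<close> into squares of Hermite polynomials loses
  nothing for a single variable: the bounds \<open>2 \<sqdot> 1!\<close> and \<open>2!\<close> for the two squares add up to
  \<open>E[1 + G^4] = 4\<close>. So bounding each term of the expanded product gives the sharp constant.
\<close>

theorem expectation_prod_one_plus_fourth_power_ge:
  assumes "\<And>j. j \<in> I \<Longrightarrow> cov j j = 1"
  shows "4 ^ card I \<le> gexpect (\<lambda>x. \<Prod>j\<in>I. 1 + x j ^ 4)"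
proof -
  \<comment> \<open>The factorials are \<open>1! = 1\<close> on \<open>T\<close> and \<open>2! = 2\<close> on its complement.\<close>
  have *: "2 ^ card (I - T) \<le> gexpect (\<lambda>x. (\<Prod>j\<in>T. (x j)\<^sup>2) * (\<Prod>j\<in>I - T. ((x j)\<^sup>2 - 1)\<^sup>2))"
    if T: "T \<subseteq> I" for T
  proof -
    define n where "n = (\<lambda>j. if j \<in> T then 1 else 2 :: nat)"
    define p where "p = (\<lambda>j x. if j \<in> T then x j else (x j)\<^sup>2 - 1 :: real)"
    have split: "(\<Prod>j\<in>I. F j) = (\<Prod>j\<in>T. F j) * (\<Prod>j\<in>I - T. F j)" for F :: "'i \<Rightarrow> real"
      using prod.subset_diff[OF T finite_I, of F] by (simp add: mult.commute)
    have "poly_lt I (n j) (\<lambda>x. p j x - x j ^ n j)" if "j \<in> I" for j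
      by (auto simp: n_def p_def poly_lt.zero poly_lt_const)
    then have "(\<Prod>j\<in>I. fact (n j)) \<le> gexpect (\<lambda>x. \<Prod>j\<in>I. (p j x)\<^sup>2)"
      using assms by (intro expectation_square_prod_ge) auto
    moreover have "(\<Prod>j\<in>I. fact (n j)) = (2 :: real) ^ card (I - T)"
      unfolding split by (simp add: n_def)
    ultimately show ?thesis
      unfolding split by (simp add: p_def)
  qed
  have fin: "finite (Pow I)" using finite_I by simp
  have "gexpect (\<lambda>x. \<Prod>j\<in>I. 1 + x j ^ 4) = gexpect (\<lambda>x. \<Prod>j\<in>I. 2 * (x j)\<^sup>2 + ((x j)\<^sup>2 - 1)\<^sup>2)"
    by (simp add: power2_eq_square power4_eq_xxxx algebra_simps)
  also have "\<dots> = gexpect (\<lambda>x. \<Sum>T\<in>Pow I. 2 ^ card T * ((\<Prod>j\<in>T. (x j)\<^sup>2) * (\<Prod>j\<in>I - T. ((x j)\<^sup>2 - 1)\<^sup>2)))"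
    by (simp add: prod_add[OF finite_I] prod.distrib mult.assoc)
  also have "\<dots> = (\<Sum>T\<in>Pow I. 2 ^ card T * gexpect (\<lambda>x. (\<Prod>j\<in>T. (x j)\<^sup>2) * (\<Prod>j\<in>I - T. ((x j)\<^sup>2 - 1)\<^sup>2)))"
    by (rule gexpect_sum[OF fin])
      (auto intro!: is_poly_mult is_poly_prod is_poly_power is_poly_diff is_poly_coord is_poly_const)
  also have "\<dots> \<ge> (\<Sum>T\<in>Pow I. 2 ^ card T * 2 ^ card (I - T))"
    using * by (intro sum_mono mult_left_mono) auto
  also have "(\<Sum>T\<in>Pow I. 2 ^ card T * 2 ^ card (I - T)) = (\<Prod>j\<in>I. 2 + 2 :: real)"
    by (subst prod_add[OF finite_I]) simp
  finally show ?thesis by simp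
qed

end

section \<open>Moments of the normal law\<close>

lemma has_bochner_integral_normal_law_iff:
  fixes f :: "real \<Rightarrow> real"
  assumes "0 < s" "f \<in> borel_measurable borel"
  shows "has_bochner_integral (normal_law m s) f I \<longleftrightarrow>
    has_bochner_integral lborel (\<lambda>x. normal_density m s x * f x) I"
  using assms
  by (auto simp: normal_law_def has_bochner_integral_iff integrable_real_density integral_real_density)

lemma normal_law_mean: "0 \<le> s \<Longrightarrow> (\<integral>x. x \<partial>normal_law m s) = m"
proof -
  assume "0 \<le> s"
  show ?thesis
  proof (cases "s = 0")
    case True
    then show ?thesis by (simp add: normal_law_def integral_return)
  next
    case False
    with \<open>0 \<le> s\<close> have s: "0 < s" by simp
    from normal_moment_nz_1[OF s, of m]
    have "has_bochner_integral (normal_law m s) (\<lambda>x. x) m"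
      using s by (simp add: has_bochner_integral_normal_law_iff)
    then show ?thesis by (rule has_bochner_integral_integral_eq)
  qed
qed

text \<open>
  The moments of the centered normal law, defined by their recursion instead of the closed form.
  The recursion needs no division by \<open>s\<close> and no distinction of parity.
\<close>

fun normal_moment :: "real \<Rightarrow> nat \<Rightarrow> real" where
  "normal_moment s 0 = 1"
| "normal_moment s (Suc 0) = 0"
| "normal_moment s (Suc (Suc n)) = (real n + 1) * s\<^sup>2 * normal_moment s n"

lemma normal_moment_odd_eq: "normal_moment s (2 * k + 1) = 0"
  by (induction k) auto

lemma normal_moment_even_eq:
  assumes "s \<noteq> 0"
  shows "normal_moment s (2 * k) = fact (2 * k) / ((2 / s\<^sup>2) ^ k * fact k)"
proof (induction k)
  case 0
  show ?case by simp
next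
  case (Suc k)
  define X where "X = (2 / s\<^sup>2) ^ k * fact k"
  have X: "X \<noteq> 0" using assms by (simp add: X_def)
  have "normal_moment s (2 * Suc k) = (2 * real k + 1) * s\<^sup>2 * (fact (2 * k) / X)"
    using Suc.IH by (simp add: X_def)
  also have "\<dots> = (2 * real k + 2) * (2 * real k + 1) * fact (2 * k) / ((2 / s\<^sup>2) * (real k + 1) * X)"
    using assms X by (simp add: divide_simps)
  also have "(2 * real k + 2) * (2 * real k + 1) * fact (2 * k) = fact (2 * Suc k)"
    by (simp add: algebra_simps)
  also have "(2 / s\<^sup>2) * (real k + 1) * X = (2 / s\<^sup>2) ^ Suc k * fact (Suc k)"
    by (simp add: X_def mult_ac add.commute)
  finally show ?case .
qed

lemma has_bochner_integral_normal_law_power: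
  assumes "0 \<le> s"
  shows "has_bochner_integral (normal_law 0 s) (\<lambda>x. x ^ n) (normal_moment s n)"
proof (cases "s = 0")
  case True
  have "normal_moment 0 n = 0 ^ n"
    by (cases "(0::real, n)" rule: normal_moment.cases) auto
  moreover have "integrable (return borel 0) (\<lambda>x::real. x ^ n)"
    by (simp add: integrable_iff_bounded nn_integral_return)
  ultimately show ?thesis
    using True by (simp add: normal_law_def has_bochner_integral_iff integral_return)
next
  case False
  with assms have s: "0 < s" by simp
  have "has_bochner_integral lborel (\<lambda>x. normal_density 0 s x * x ^ n) (normal_moment s n)"
  proof (cases "even n")
    case True
    then obtain k where "n = 2 * k" by (auto elim: evenE)
    then show ?thesis using normal_moment_even[OF s, of 0 k] s by (simp add: normal_moment_even_eq)
  next
    case False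
    then obtain k where "n = 2 * k + 1" by (auto elim: oddE)
    then show ?thesis using normal_moment_odd[OF s, of 0 k] normal_moment_odd_eq[of s k] by simp
  qed
  then show ?thesis by (simp add: has_bochner_integral_normal_law_iff[OF s])
qed

text \<open>
  A linear combination has a normal law by hypothesis; that its mean vanishes is inherited from
  the coordinates, once these are known to be integrable. For a single coordinate the mean in
  the law is its expectation, which is assumed to vanish.
\<close>

lemma gaussian_vector_imp_gaussian_family:
  assumes "prob_space M" "gaussian_vector M d G"
    and centered: "\<And>i. i \<in> {1..d} \<Longrightarrow> prob_space.expectation M (G i) = 0"
  shows "gaussian_family M {1..d} G"
proof -
  interpret prob_space M by fact
  let ?Y = "\<lambda>a \<omega>. \<Sum>i\<in>{1..d}. a i * G i \<omega>"
  have meas: "G i \<in> borel_measurable M" if "i \<in> {1..d}" for i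
    using assms(2) that by (simp add: gaussian_vector_def)
  have measY: "?Y a \<in> borel_measurable M" for a
    using meas by (intro borel_measurable_sum borel_measurable_times) auto
  have law: "\<exists>m s. 0 \<le> s \<and> distr M borel (?Y a) = normal_law m s" for a
    using assms(2) by (simp add: gaussian_vector_def)
  have mean: "m = expectation (?Y a)" if "0 \<le> s" "distr M borel (?Y a) = normal_law m s" for a m s
    using normal_law_mean[OF that(1), of m] integral_distr[OF measY, of "\<lambda>x. x" a] that(2) by simp
  have moments: "has_bochner_integral M (\<lambda>\<omega>. ?Y a \<omega> ^ n) (normal_moment s n)"
    if "0 \<le> s" "distr M borel (?Y a) = normal_law 0 s" for a s n
    using has_bochner_integral_normal_law_power[OF that(1), of n] measY[of a] that(2)
    by (simp flip: that(2) add: has_bochner_integral_iff integrable_distr_eq integral_distr)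
  have coord: "(\<Sum>j\<in>{1..d}. (if j = i then 1 else 0) * G j \<omega>) = G i \<omega>" if "i \<in> {1..d}" for i \<omega>
    using that by (simp add: if_distrib[of "\<lambda>t. t * _"] cong: if_cong)
  have int_coord: "integrable M (G i)" if i: "i \<in> {1..d}" for i
  proof -
    let ?e = "\<lambda>j. if j = i then 1 else 0"
    have e: "?Y ?e = G i" using coord[OF i] by (simp add: fun_eq_iff)
    obtain m s where ms: "0 \<le> s" "distr M borel (?Y ?e) = normal_law m s"
      using law[of ?e] by (elim exE conjE)
    have "m = 0" using mean[OF ms] centered[OF i] unfolding e by simp
    with ms(2) have "distr M borel (?Y ?e) = normal_law 0 s" by (simp only:)
    from integrable.intros[OF moments[OF ms(1) this, of 1]] show ?thesis
      unfolding power_one_right e .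
  qed
  have centeredY: "expectation (?Y a) = 0" for a
    using int_coord centered by (simp add: Bochner_Integration.integral_sum)
  have law0: "\<exists>s. \<forall>n. has_bochner_integral M (\<lambda>\<omega>. ?Y a \<omega> ^ n) (normal_moment s n)" for a
  proof -
    obtain m s where ms: "0 \<le> s" "distr M borel (?Y a) = normal_law m s"
      using law[of a] by (elim exE conjE)
    have "m = 0" using mean[OF ms] centeredY by simp
    with ms(2) have "distr M borel (?Y a) = normal_law 0 s" by (simp only:)
    from moments[OF ms(1) this] show ?thesis by (intro exI allI)
  qed
  show ?thesis
  proof
    fix a n
    obtain s where s: "\<And>n. has_bochner_integral M (\<lambda>\<omega>. ?Y a \<omega> ^ n) (normal_moment s n)"
      using law0[of a] by blast
    show "integrable M (\<lambda>\<omega>. ?Y a \<omega> ^ n)" using s by (auto simp: has_bochner_integral_iff)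
    show "expectation (\<lambda>\<omega>. ?Y a \<omega> ^ (n + 2)) =
      (real n + 1) * expectation (\<lambda>\<omega>. ?Y a \<omega> ^ 2) * expectation (\<lambda>\<omega>. ?Y a \<omega> ^ n)"
      unfolding has_bochner_integral_integral_eq[OF s] by (simp add: numeral_2_eq_2)
  qed (use meas centered in auto)
qed

theorem proposition1p1:
  fixes M :: "'a measure" and d :: nat and G :: "nat \<Rightarrow> 'a \<Rightarrow> real"
  assumes "d \<ge> 2"
    and "prob_space M"
    and "gaussian_vector M d G"
    and "\<And>i. i \<in> {1..d} \<Longrightarrow> prob_space.expectation M (G i) = 0"
    and "\<And>i. i \<in> {1..d} \<Longrightarrow> prob_space.variance M (G i) = 1"
  shows "(\<Sum>S\<in>Pow {1..d}. prob_space.expectation M (\<lambda>\<omega>. \<Prod>i\<in>S. G i \<omega> ^ 4))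
       \<ge> (\<Sum>S\<in>Pow {1..d}. \<Prod>i\<in>S. prob_space.expectation M (\<lambda>\<omega>. G i \<omega> ^ 4))"
proof -
  interpret gaussian_family M "{1..d}" G
    by (rule gaussian_vector_imp_gaussian_family[OF assms(2-4)])
  have var: "cov i i = 1" if "i \<in> {1..d}" for i
    using assms(4,5)[OF that] by (simp add: cov_def gexpect_def power2_eq_square)
  \<comment> \<open>Stein's formula gives \<open>E[G^4] = 3 E[G\<^sup>2]\<close>.\<close>
  have fourth: "expectation (\<lambda>\<omega>. G i \<omega> ^ 4) = 3" if i: "i \<in> {1..d}" for i
  proof -
    have "gexpect (\<lambda>x. x i * (x i) ^ 3) = gexpect (\<lambda>x. 3 * (x i * x i))"
      using stein[OF i, of "\<lambda>x. x i ^ 3"] i var[OF i]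
      by (simp add: dir_deriv_power[OF is_poly_coord] is_poly_power is_poly_coord power2_eq_square)
    also have "\<dots> = 3" using var[OF i] by (simp add: gexpect_cmult cov_def)
    finally show ?thesis by (simp add: gexpect_def eval_nat_numeral mult_ac)
  qed
  have "(\<Sum>S\<in>Pow {1..d}. \<Prod>i\<in>S. expectation (\<lambda>\<omega>. G i \<omega> ^ 4)) = (\<Sum>S\<in>Pow {1..d}. \<Prod>i\<in>S. 3)"
    using fourth by (intro sum.cong prod.cong) auto
  also have "\<dots> = (\<Prod>i\<in>{1..d}. 3 + 1)"
    by (subst prod_add) auto
  also have "\<dots> = 4 ^ card {1..d}" by simp
  also have "\<dots> \<le> gexpect (\<lambda>x. \<Prod>i\<in>{1..d}. 1 + x i ^ 4)"
    using var by (rule expectation_prod_one_plus_fourth_power_ge)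
  also have "\<dots> = gexpect (\<lambda>x. \<Sum>S\<in>Pow {1..d}. 1 * (\<Prod>i\<in>S. x i ^ 4))"
    by (simp add: add.commute[of 1] prod_add)
  also have "\<dots> = (\<Sum>S\<in>Pow {1..d}. 1 * gexpect (\<lambda>x. \<Prod>i\<in>S. x i ^ 4))"
    by (rule gexpect_sum) (auto intro!: is_poly_prod is_poly_power is_poly_coord)
  finally show ?thesis by (simp add: gexpect_def)
qed

end
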